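(* Let $\mathfrak{n}=\mathfrak{sl}_2(\mathbb{C})\oplus\mathfrak{sl}_2(\mathbb{C})$ with bracket $\{\,,\}$ and basis $e_1=E_{12}$, $e_2=E_{21}$, $e_3=E_{11}-E_{22}$, $e_4=E_{45}$, $e_5=E_{54}$, $e_6=E_{44}-E_{55}$. Then there exists a post-Lie algebra structure on a pair $(\mathfrak{g},\mathfrak{n})$ with $\mathfrak{g}\cong\mathfrak{r}_2(\mathbb{C})\oplus\mathfrak{r}_2(\mathbb{C})\oplus\mathfrak{r}_2(\mathbb{C})$. It is given by $x\cdot y=\{\phi(x),y\}$, where $\phi$ is the linear map with $$\phi(e_2)=-e_2,\qquad \phi(e_5)=-e_3-e_5,\qquad \phi(e_1)=\phi(e_3)=\phi(e_4)=\phi(e_6)=0,$$ where the Lie brackets $[e_i,e_j]$, $i<j$, of $\mathfrak{g}$ are given by $[e_1,e_3]=-2e_1$, $[e_1,e_5]=2e_1$, $[e_2,e_5]=-2e_2$, $[e_4,e_6]=-2e_4$ (all others zero), and the post-Lie algebra structure is given explicitly by $e_2\cdot e_1=e_3$, $e_2\cdot e_3=-2e_2$, $e_5\cdot e_1=-2e_1$, $e_5\cdot e_2=2e_2$, $e_5\cdot e_4=e_6$, $e_5\cdot e_6=-2e_5$ (all other products $e_i\cdot e_j$ zero).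
   Context: Let $\mathfrak{g}=(V,[\,,])$ and $\mathfrak{n}=(V,\{\,,\})$ be two Lie algebra structures on the same complex vector space $V$. A post-Lie algebra structure on the pair $(\mathfrak{g},\mathfrak{n})$ is a bilinear product $(x,y)\mapsto x\cdot y$ on $V$ such that for all $x,y,z\in V$: (i) $x\cdot y-y\cdot x=[x,y]-\{x,y\}$; (ii) $[x,y]\cdot z=x\cdot(y\cdot z)-y\cdot(x\cdot z)$; (iii) $x\cdot\{y,z\}=\{x\cdot y,z\}+\{y,x\cdot z\}$. $\mathfrak{r}_2(\mathbb{C})$ is the $2$-dimensional non-abelian complex Lie algebra. $E_{ij}$ is the matrix with entry $1$ at position $(i,j)$ and zeros elsewhere, and $\mathfrak{n}$ carries the matrix commutator: $(e_1,e_2,e_3)$ and $(e_4,e_5,e_6)$ are standard bases of two commuting copies of $\mathfrak{sl}_2(\mathbb{C})$, i.e. $\{e_1,e_2\}=e_3$, $\{e_1,e_3\}=-2e_1$, $\{e_2,e_3\}=2e_2$, $\{e_4,e_5\}=e_6$, $\{e_4,e_6\}=-2e_4$, $\{e_5,e_6\}=2e_5$, and all brackets between the two copies vanish. *)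

theory Defs
  imports "HOL-Analysis.Analysis"
begin

section \<open>Complex Lie algebras\<close>

text \<open>The addition is that of the ambient type; the carrier is required to be a subspace of it.\<close>

record 'a lie_alg =
  lcarrier :: "'a set"
  lscale :: "complex \<Rightarrow> 'a \<Rightarrow> 'a"
  lbracket :: "'a \<Rightarrow> 'a \<Rightarrow> 'a"

definition carrier_linear ::
    "'a::ab_group_add lie_alg \<Rightarrow> 'b::ab_group_add lie_alg \<Rightarrow> ('a \<Rightarrow> 'b) \<Rightarrow> bool" where
  "carrier_linear L M f \<longleftrightarrow>
     f \<in> lcarrier L \<rightarrow> lcarrier M \<and>
     (\<forall>x\<in>lcarrier L. \<forall>y\<in>lcarrier L. f (x + y) = f x + f y) \<and>
     (\<forall>c. \<forall>x\<in>lcarrier L. f (lscale L c x) = lscale M c (f x))"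

definition carrier_bilinear :: "'a::ab_group_add lie_alg \<Rightarrow> ('a \<Rightarrow> 'a \<Rightarrow> 'a) \<Rightarrow> bool" where
  "carrier_bilinear L m \<longleftrightarrow>
     (\<forall>x\<in>lcarrier L. carrier_linear L L (\<lambda>y. m x y)) \<and>
     (\<forall>y\<in>lcarrier L. carrier_linear L L (\<lambda>x. m x y))"

definition lie_algebra :: "'a::ab_group_add lie_alg \<Rightarrow> bool" where
  "lie_algebra L \<longleftrightarrow>
     vector_space (lscale L) \<and>
     module.subspace (lscale L) (lcarrier L) \<and>
     carrier_bilinear L (lbracket L) \<and>
     (\<forall>x\<in>lcarrier L. lbracket L x x = 0) \<and>
     (\<forall>x\<in>lcarrier L. \<forall>y\<in>lcarrier L. \<forall>z\<in>lcarrier L.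
        lbracket L x (lbracket L y z) + lbracket L y (lbracket L z x)
          + lbracket L z (lbracket L x y) = 0)"

definition lie_isomorphic :: "'a::ab_group_add lie_alg \<Rightarrow> 'b::ab_group_add lie_alg \<Rightarrow> bool"
    (infix "\<cong>\<^sub>L" 50) where
  "L \<cong>\<^sub>L M \<longleftrightarrow>
     (\<exists>f. carrier_linear L M f \<and> bij_betw f (lcarrier L) (lcarrier M) \<and>
          (\<forall>x\<in>lcarrier L. \<forall>y\<in>lcarrier L. f (lbracket L x y) = lbracket M (f x) (f y)))"

definition lie_direct_sum :: "'a lie_alg \<Rightarrow> 'b lie_alg \<Rightarrow> ('a \<times> 'b) lie_alg"
    (infixr "\<oplus>\<^sub>L" 65) where
  "L \<oplus>\<^sub>L M =
     \<lparr> lcarrier = lcarrier L \<times> lcarrier M,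
       lscale = (\<lambda>c (x, y). (lscale L c x, lscale M c y)),
       lbracket = (\<lambda>(x, y) (x', y'). (lbracket L x x', lbracket M y y')) \<rparr>"

section \<open>Post-Lie algebra structures\<close>

definition post_lie_structure ::
    "'a::ab_group_add lie_alg \<Rightarrow> 'a lie_alg \<Rightarrow> ('a \<Rightarrow> 'a \<Rightarrow> 'a) \<Rightarrow> bool" where
  "post_lie_structure \<gg> \<nn> p \<longleftrightarrow>
     lie_algebra \<gg> \<and> lie_algebra \<nn> \<and>
     lcarrier \<gg> = lcarrier \<nn> \<and> lscale \<gg> = lscale \<nn> \<and>
     carrier_bilinear \<nn> p \<and>
     (\<forall>x\<in>lcarrier \<nn>. \<forall>y\<in>lcarrier \<nn>.
        p x y - p y x = lbracket \<gg> x y - lbracket \<nn> x y) \<and>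
     (\<forall>x\<in>lcarrier \<nn>. \<forall>y\<in>lcarrier \<nn>. \<forall>z\<in>lcarrier \<nn>.
        p (lbracket \<gg> x y) z = p x (p y z) - p y (p x z)) \<and>
     (\<forall>x\<in>lcarrier \<nn>. \<forall>y\<in>lcarrier \<nn>. \<forall>z\<in>lcarrier \<nn>.
        p x (lbracket \<nn> y z) = lbracket \<nn> (p x y) z + lbracket \<nn> y (p x z))"

section \<open>The Lie algebras involved\<close>

text \<open>The model of the 2-dimensional non-abelian Lie algebra with basis
  \<open>f\<^sub>1 = (1, 0)\<close>, \<open>f\<^sub>2 = (0, 1)\<close> and \<open>[f\<^sub>1, f\<^sub>2] = f\<^sub>1\<close>. Every 2-dimensional
  non-abelian complex Lie algebra is isomorphic to it.\<close>

definition r2 :: "(complex \<times> complex) lie_alg" where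
  "r2 = \<lparr> lcarrier = UNIV,
          lscale = (\<lambda>c (a, b). (c * a, c * b)),
          lbracket = (\<lambda>(a, b) (a', b'). (a * b' - b * a', 0)) \<rparr>"

definition matrix_scale :: "complex \<Rightarrow> complex^'n^'m \<Rightarrow> complex^'n^'m" where
  "matrix_scale c A = (\<chi> i j. c * A $ i $ j)"

definition commutator :: "complex^'n^'n \<Rightarrow> complex^'n^'n \<Rightarrow> complex^'n^'n" where
  "commutator A B = A ** B - B ** A"

definition sl2 :: "(complex^2^2) lie_alg" where
  "sl2 = \<lparr> lcarrier = {A. trace A = 0}, lscale = matrix_scale, lbracket = commutator \<rparr>"

definition matrix_unit :: "'n \<Rightarrow> 'n \<Rightarrow> complex^'n^'n" where
  "matrix_unit i j = axis i (axis j 1)"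

text \<open>The matrices are 5 by 5, the smallest size in which \<open>E\<^sub>4\<^sub>5\<close> makes sense.
  In the index type \<open>5\<close> the numeral \<open>5\<close> denotes the same element as \<open>0\<close>; the five
  indices \<open>1, \<dots>, 5\<close> are nevertheless pairwise distinct. The algebra \<open>\<nn>\<close> consists of the
  matrices supported on the diagonal blocks with rows and columns \<open>1, 2\<close> and \<open>4, 5\<close>,
  both blocks having trace zero.\<close>

definition n_alg :: "(complex^5^5) lie_alg" where
  "n_alg =
     \<lparr> lcarrier = {A. A $ 1 $ 1 + A $ 2 $ 2 = 0 \<and> A $ 4 $ 4 + A $ 5 $ 5 = 0 \<and>
                     (\<forall>i j. (i, j) \<notin> {1, 2} \<times> {1, 2} \<union> {4, 5} \<times> {4, 5} \<longrightarrow> A $ i $ j = 0)},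
       lscale = matrix_scale, lbracket = commutator \<rparr>"

definition e :: "nat \<Rightarrow> complex^5^5" where
  "e i = (if i = 1 then matrix_unit 1 2
          else if i = 2 then matrix_unit 2 1
          else if i = 3 then matrix_unit 1 1 - matrix_unit 2 2
          else if i = 4 then matrix_unit 4 5
          else if i = 5 then matrix_unit 5 4
          else if i = 6 then matrix_unit 4 4 - matrix_unit 5 5
          else 0)"

end

theory Submission
  imports Defs
begin

text \<open>The map \<open>\<phi>\<close> satisfies \<open>\<phi>\<^sup>2 = -\<phi>\<close>, so \<open>-\<phi>\<close> is a projection. Its image is
  \<open>\<bb> = \<langle>e\<^sub>2, e\<^sub>3 + e\<^sub>5\<rangle>\<close> and its kernel is \<open>\<aa> = \<langle>e\<^sub>1, e\<^sub>3, e\<^sub>4, e\<^sub>6\<rangle>\<close>. Both are subalgebras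
  of \<open>\<nn>\<close>. The negative of the projection onto one summand of such a splitting is a Rota-Baxter
  operator of weight \<open>1\<close>: it satisfies \<open>\<phi> [x, y] = {\<phi> x, \<phi> y}\<close> for the bracket
  \<open>[x, y] = {\<phi> x, y} + {x, \<phi> y} + {x, y}\<close>.

  Every Rota-Baxter operator of weight \<open>1\<close> makes \<open>[,]\<close> a Lie bracket and \<open>x \<cdot> y = {\<phi> x, y}\<close> a
  post-Lie structure (\<open>rota_baxter_post_lie\<close>). The three post-Lie axioms are, in turn, the
  definition of \<open>[,]\<close>, the fact that \<open>ad\<close> turns the identity \<open>\<phi> [x, y] = {\<phi> x, \<phi> y}\<close> into a
  commutator, and the fact that \<open>ad (\<phi> x)\<close> is a derivation.

  For a splitting, \<open>[,]\<close> equals \<open>{,}\<close> on \<open>\<aa>\<close>, equals \<open>-{,}\<close> on \<open>\<bb>\<close>, and vanishes between \<open>\<aa>\<close>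
  and \<open>\<bb>\<close>. Here \<open>\<aa> = \<langle>e\<^sub>1, e\<^sub>3\<rangle> \<oplus> \<langle>e\<^sub>4, e\<^sub>6\<rangle>\<close>, so \<open>\<gg>\<close> is a sum of three non-abelian
  2-dimensional algebras (\<open>g_alg_iso_r2_sum\<close>). That \<open>\<phi>\<close> is Rota-Baxter, and the multiplication
  tables, are read off in coordinates: an element of \<open>\<nn>\<close> is determined by six of its entries
  (\<open>n_alg_eqI\<close>), and for these the commutator is given by explicit bilinear formulas
  (\<open>n_commutator_entries\<close>).\<close>

section \<open>Rota-Baxter operators of weight one\<close>

definition descendent_bracket :: "'a::ab_group_add lie_alg \<Rightarrow> ('a \<Rightarrow> 'a) \<Rightarrow> 'a \<Rightarrow> 'a \<Rightarrow> 'a" where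
  "descendent_bracket L \<phi> x y = lbracket L (\<phi> x) y + lbracket L x (\<phi> y) + lbracket L x y"

definition rota_baxter :: "'a::ab_group_add lie_alg \<Rightarrow> ('a \<Rightarrow> 'a) \<Rightarrow> bool" where
  "rota_baxter L \<phi> \<longleftrightarrow> carrier_linear L L \<phi> \<and>
     (\<forall>x\<in>lcarrier L. \<forall>y\<in>lcarrier L.
        \<phi> (descendent_bracket L \<phi> x y) = lbracket L (\<phi> x) (\<phi> y))"

context
  fixes L :: "'a::ab_group_add lie_alg"
  assumes L: "lie_algebra L"
begin

lemma lie_add_closed: "x \<in> lcarrier L \<Longrightarrow> y \<in> lcarrier L \<Longrightarrow> x + y \<in> lcarrier L"
  and lie_scale_closed: "x \<in> lcarrier L \<Longrightarrow> lscale L c x \<in> lcarrier L"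
  and lie_scale_add: "lscale L c (x + y) = lscale L c x + lscale L c y"
proof -
  interpret vector_space "lscale L" using L by (simp add: lie_algebra_def)
  have S: "subspace (lcarrier L)" using L by (simp add: lie_algebra_def)
  show "x \<in> lcarrier L \<Longrightarrow> y \<in> lcarrier L \<Longrightarrow> x + y \<in> lcarrier L"
    and "x \<in> lcarrier L \<Longrightarrow> lscale L c x \<in> lcarrier L"
    and "lscale L c (x + y) = lscale L c x + lscale L c y"
    using S by (auto intro: subspace_add subspace_scale simp: scale_right_distrib)
qed

lemma lie_bracket_closed:
    "x \<in> lcarrier L \<Longrightarrow> y \<in> lcarrier L \<Longrightarrow> lbracket L x y \<in> lcarrier L"
  and lie_bracket_add_right:
    "x \<in> lcarrier L \<Longrightarrow> y \<in> lcarrier L \<Longrightarrow> z \<in> lcarrier L \<Longrightarrow>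
       lbracket L x (y + z) = lbracket L x y + lbracket L x z"
  and lie_bracket_add_left:
    "x \<in> lcarrier L \<Longrightarrow> y \<in> lcarrier L \<Longrightarrow> z \<in> lcarrier L \<Longrightarrow>
       lbracket L (x + y) z = lbracket L x z + lbracket L y z"
  and lie_bracket_scale_right:
    "x \<in> lcarrier L \<Longrightarrow> y \<in> lcarrier L \<Longrightarrow> lbracket L x (lscale L c y) = lscale L c (lbracket L x y)"
  and lie_bracket_scale_left:
    "x \<in> lcarrier L \<Longrightarrow> y \<in> lcarrier L \<Longrightarrow> lbracket L (lscale L c x) y = lscale L c (lbracket L x y)"
  and lie_bracket_self: "x \<in> lcarrier L \<Longrightarrow> lbracket L x x = 0"
  and lie_jacobi:
    "x \<in> lcarrier L \<Longrightarrow> y \<in> lcarrier L \<Longrightarrow> z \<in> lcarrier L \<Longrightarrow>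
       lbracket L x (lbracket L y z) + lbracket L y (lbracket L z x) + lbracket L z (lbracket L x y) = 0"
  using L unfolding lie_algebra_def carrier_bilinear_def carrier_linear_def by auto

lemma lie_bracket_swap:
  assumes "x \<in> lcarrier L" "y \<in> lcarrier L"
  shows "lbracket L y x = - lbracket L x y"
proof -
  have "lbracket L (x + y) (x + y) = lbracket L x y + lbracket L y x"
    using assms by (simp add: lie_bracket_add_left lie_bracket_add_right lie_add_closed
        lie_bracket_self[OF assms(1)] lie_bracket_self[OF assms(2)])
  moreover have "lbracket L (x + y) (x + y) = 0"
    using assms by (intro lie_bracket_self lie_add_closed)
  ultimately show ?thesis
    by (simp add: eq_neg_iff_add_eq_0 add.commute)
qed

lemma lie_bracket_minus_right:
  assumes "x \<in> lcarrier L" "y \<in> lcarrier L" "- y \<in> lcarrier L"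
  shows "lbracket L x (- y) = - lbracket L x y"
proof -
  have "0 \<in> lcarrier L" using lie_bracket_self[OF assms(1)] lie_bracket_closed[OF assms(1,1)] by simp
  then have "lbracket L x 0 = 0" using lie_bracket_add_right[of x 0 0] assms by simp
  then show ?thesis using lie_bracket_add_right[of x y "- y"] assms
    by (simp add: eq_neg_iff_add_eq_0 add.commute)
qed

lemma lie_minus_closed: "x \<in> lcarrier L \<Longrightarrow> - x \<in> lcarrier L"
proof -
  interpret vector_space "lscale L" using L by (simp add: lie_algebra_def)
  show "x \<in> lcarrier L \<Longrightarrow> - x \<in> lcarrier L"
    using lie_scale_closed[of x "-1"] by simp
qed

text \<open>This is the Jacobi identity, read as: \<open>ad x\<close> is a derivation. It yields the third post-Lie axiom,
  and after moving one term across also the second.\<close>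

lemma lie_bracket_derivation:
  assumes "x \<in> lcarrier L" "y \<in> lcarrier L" "z \<in> lcarrier L"
  shows "lbracket L x (lbracket L y z) = lbracket L (lbracket L x y) z + lbracket L y (lbracket L x z)"
proof -
  have "lbracket L y (lbracket L z x) = - lbracket L y (lbracket L x z)"
    using assms by (simp add: lie_bracket_swap[of x z] lie_bracket_minus_right lie_bracket_closed lie_minus_closed)
  moreover have "lbracket L z (lbracket L x y) = - lbracket L (lbracket L x y) z"
    using assms by (intro lie_bracket_swap lie_bracket_closed)
  ultimately show ?thesis
    using lie_jacobi[OF assms] by (simp add: algebra_simps)
qed

context
  fixes \<phi> :: "'a \<Rightarrow> 'a"
  assumes \<phi>: "rota_baxter L \<phi>"
begin

lemma rb_closed: "x \<in> lcarrier L \<Longrightarrow> \<phi> x \<in> lcarrier L"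
  and rb_add: "x \<in> lcarrier L \<Longrightarrow> y \<in> lcarrier L \<Longrightarrow> \<phi> (x + y) = \<phi> x + \<phi> y"
  and rb_scale: "x \<in> lcarrier L \<Longrightarrow> \<phi> (lscale L c x) = lscale L c (\<phi> x)"
  and rb_bracket: "x \<in> lcarrier L \<Longrightarrow> y \<in> lcarrier L \<Longrightarrow>
        \<phi> (descendent_bracket L \<phi> x y) = lbracket L (\<phi> x) (\<phi> y)"
  using \<phi> unfolding rota_baxter_def carrier_linear_def by auto

lemmas rb_closure = rb_closed lie_add_closed lie_scale_closed lie_bracket_closed

lemma descendent_closed:
  "x \<in> lcarrier L \<Longrightarrow> y \<in> lcarrier L \<Longrightarrow> descendent_bracket L \<phi> x y \<in> lcarrier L"
  by (simp add: descendent_bracket_def rb_closure)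

text \<open>The Rota-Baxter identity enters only through the term \<open>{x, \<phi> [y, z]}\<close>. It becomes
  \<open>{x, {\<phi> y, \<phi> z}}\<close>, which leaves one term for each way of applying \<open>\<phi>\<close> to some but not all of
  the three arguments.\<close>

lemma descendent_nested:
  assumes "x \<in> lcarrier L" "y \<in> lcarrier L" "z \<in> lcarrier L"
  shows "descendent_bracket L \<phi> x (descendent_bracket L \<phi> y z) =
     lbracket L (\<phi> x) (lbracket L (\<phi> y) z) + lbracket L (\<phi> x) (lbracket L y (\<phi> z))
     + lbracket L (\<phi> x) (lbracket L y z) + lbracket L x (lbracket L (\<phi> y) (\<phi> z))
     + lbracket L x (lbracket L (\<phi> y) z) + lbracket L x (lbracket L y (\<phi> z))
     + lbracket L x (lbracket L y z)"
proof -
  have "descendent_bracket L \<phi> x (descendent_bracket L \<phi> y z) =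
      lbracket L (\<phi> x) (descendent_bracket L \<phi> y z) + lbracket L x (lbracket L (\<phi> y) (\<phi> z))
      + lbracket L x (descendent_bracket L \<phi> y z)"
    using assms by (subst descendent_bracket_def) (simp add: rb_bracket)
  then show ?thesis
    using assms by (simp add: descendent_bracket_def rb_closure lie_bracket_add_right add_ac)
qed

text \<open>In the cyclic sum of \<open>descendent_nested\<close>, the terms with \<open>\<phi>\<close> applied to a given proper subset of
  \<open>{x, y, z}\<close> form one Jacobi expression of \<open>{,}\<close>. There are seven such subsets.\<close>

lemma descendent_jacobi:
  assumes "x \<in> lcarrier L" "y \<in> lcarrier L" "z \<in> lcarrier L"
  shows "descendent_bracket L \<phi> x (descendent_bracket L \<phi> y z)
    + descendent_bracket L \<phi> y (descendent_bracket L \<phi> z x)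
    + descendent_bracket L \<phi> z (descendent_bracket L \<phi> x y) = 0" (is "?S = 0")
proof -
  define J where "J a b c = lbracket L a (lbracket L b c) + lbracket L b (lbracket L c a)
     + lbracket L c (lbracket L a b)" for a b c
  have "?S = J (\<phi> x) (\<phi> y) z + J (\<phi> x) y (\<phi> z) + J x (\<phi> y) (\<phi> z)
      + J (\<phi> x) y z + J x (\<phi> y) z + J x y (\<phi> z) + J x y z"
    using assms by (simp add: descendent_nested J_def add_ac)
  also have "\<dots> = 0"
    using assms by (simp add: J_def lie_jacobi rb_closed)
  finally show ?thesis .
qed

lemma descendent_lie_algebra: "lie_algebra (L\<lparr>lbracket := descendent_bracket L \<phi>\<rparr>)"
proof -
  have "carrier_bilinear (L\<lparr>lbracket := descendent_bracket L \<phi>\<rparr>) (descendent_bracket L \<phi>)"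
    unfolding carrier_bilinear_def carrier_linear_def
    by (auto simp: descendent_closed)
       (simp_all add: descendent_bracket_def rb_closure rb_add rb_scale lie_bracket_add_left
          lie_bracket_add_right lie_bracket_scale_left lie_bracket_scale_right lie_scale_add add_ac)
  moreover have "descendent_bracket L \<phi> x x = 0" if "x \<in> lcarrier L" for x
    using that lie_bracket_swap[of x "\<phi> x"]
    by (simp add: descendent_bracket_def lie_bracket_self rb_closed)
  ultimately show ?thesis
    using L by (auto simp: lie_algebra_def intro: descendent_jacobi)
qed

lemma rota_baxter_post_lie:
  "post_lie_structure (L\<lparr>lbracket := descendent_bracket L \<phi>\<rparr>) L (\<lambda>x y. lbracket L (\<phi> x) y)"
proof -
  have "carrier_bilinear L (\<lambda>x y. lbracket L (\<phi> x) y)"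
    unfolding carrier_bilinear_def carrier_linear_def
    by (simp add: rb_closure rb_add rb_scale lie_bracket_add_left
          lie_bracket_add_right lie_bracket_scale_left lie_bracket_scale_right)
  moreover have "lbracket L (\<phi> x) y - lbracket L (\<phi> y) x = descendent_bracket L \<phi> x y - lbracket L x y"
    if "x \<in> lcarrier L" "y \<in> lcarrier L" for x y
    using that lie_bracket_swap[of x "\<phi> y"] by (simp add: descendent_bracket_def rb_closed)
  moreover have "lbracket L (\<phi> (descendent_bracket L \<phi> x y)) z =
      lbracket L (\<phi> x) (lbracket L (\<phi> y) z) - lbracket L (\<phi> y) (lbracket L (\<phi> x) z)"
    if "x \<in> lcarrier L" "y \<in> lcarrier L" "z \<in> lcarrier L" for x y z
    using that lie_bracket_derivation[of "\<phi> x" "\<phi> y" z] by (simp add: rb_bracket rb_closed)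
  moreover have "lbracket L (\<phi> x) (lbracket L y z) =
      lbracket L (lbracket L (\<phi> x) y) z + lbracket L y (lbracket L (\<phi> x) z)"
    if "x \<in> lcarrier L" "y \<in> lcarrier L" "z \<in> lcarrier L" for x y z
    using that by (intro lie_bracket_derivation rb_closed)
  ultimately show ?thesis
    using L descendent_lie_algebra unfolding post_lie_structure_def by simp
qed

end
end

section \<open>Matrix Lie algebras\<close>

lemma UNIV_5: "(UNIV :: 5 set) = {1, 2, 3, 4, 5}"
  by (rule sym, rule card_subset_eq) simp_all

lemma forall_5: "(\<forall>i::5. P i) \<longleftrightarrow> P 1 \<and> P 2 \<and> P 3 \<and> P 4 \<and> P 5"
  by (metis (full_types) UNIV_5 UNIV_I insertE singletonD)

lemma sum_5: "sum f (UNIV :: 5 set) = f 1 + f 2 + f 3 + f 4 + f 5"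
  unfolding UNIV_5 by (simp add: add.assoc)

lemma vector_space_matrix_scale: "vector_space (matrix_scale :: complex \<Rightarrow> complex^'n^'m \<Rightarrow> _)"
  by unfold_locales (simp_all add: matrix_scale_def vec_eq_iff algebra_simps)

interpretation mat: vector_space "matrix_scale :: complex \<Rightarrow> complex^'n^'m \<Rightarrow> _"
  by (rule vector_space_matrix_scale)

lemma matrix_scale_nth [simp]: "matrix_scale c A $ i $ j = c * A $ i $ j"
  by (simp add: matrix_scale_def)

lemma matrix_scale_mult:
  fixes A :: "complex^'k^'m" and B :: "complex^'n^'k"
  shows "matrix_scale c A ** B = matrix_scale c (A ** B)"
    and "A ** matrix_scale c B = matrix_scale c (A ** B)"
  by (simp_all add: vec_eq_iff matrix_matrix_mult_def sum_distrib_left algebra_simps)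

lemma matrix_mult_distribs:
  fixes A B C :: "complex^'n^'n"
  shows "A ** (B - C) = A ** B - A ** C" and "(B - C) ** A = B ** A - C ** A"
    and "(B + C) ** A = B ** A + C ** A"
  by (simp_all add: vec_eq_iff matrix_matrix_mult_def algebra_simps sum_subtractf sum.distrib)

lemma commutator_jacobi:
  "commutator A (commutator B C) + commutator B (commutator C A) + commutator C (commutator A B) = 0"
  by (simp add: commutator_def matrix_mult_distribs matrix_mul_assoc)

lemma commutator_lie_algebra:
  fixes S :: "(complex^'n^'n) set"
  assumes "mat.subspace S" and "\<And>A B. A \<in> S \<Longrightarrow> B \<in> S \<Longrightarrow> commutator A B \<in> S"
  shows "lie_algebra \<lparr>lcarrier = S, lscale = matrix_scale, lbracket = commutator\<rparr>"
  using assms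
  by (auto simp: lie_algebra_def carrier_bilinear_def carrier_linear_def vector_space_matrix_scale
      commutator_jacobi)
    (simp_all add: commutator_def matrix_add_ldistrib matrix_mult_distribs matrix_scale_mult
      mat.scale_right_diff_distrib)

section \<open>Coordinates on the sum of two copies of the special linear algebra\<close>

lemma n_alg_sel [simp]:
  "lscale n_alg = matrix_scale" "lbracket n_alg = commutator"
  by (simp_all add: n_alg_def)

lemma n_algD:
  assumes "A \<in> lcarrier n_alg"
  shows "A $ 2 $ 2 = - A $ 1 $ 1" "A $ 5 $ 5 = - A $ 4 $ 4"
    "A $ 3 $ i = 0" "A $ i $ 3 = 0"
    "A $ 1 $ 4 = 0" "A $ 1 $ 5 = 0" "A $ 2 $ 4 = 0" "A $ 2 $ 5 = 0"
    "A $ 4 $ 1 = 0" "A $ 4 $ 2 = 0" "A $ 5 $ 1 = 0" "A $ 5 $ 2 = 0"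
  using assms by (auto simp: n_alg_def add_eq_0_iff2)

lemma n_algI:
  assumes "A $ 2 $ 2 = - A $ 1 $ 1" "A $ 5 $ 5 = - A $ 4 $ 4"
    "\<And>i. A $ 3 $ i = 0" "\<And>i. A $ i $ 3 = 0"
    "A $ 1 $ 4 = 0" "A $ 1 $ 5 = 0" "A $ 2 $ 4 = 0" "A $ 2 $ 5 = 0"
    "A $ 4 $ 1 = 0" "A $ 4 $ 2 = 0" "A $ 5 $ 1 = 0" "A $ 5 $ 2 = 0"
  shows "A \<in> lcarrier n_alg"
  using assms by (simp add: n_alg_def forall_5)

text \<open>The six entries are the coordinates with respect to \<open>e 1, \<dots>, e 6\<close>.\<close>

lemma n_alg_eqI:
  assumes "A \<in> lcarrier n_alg" "B \<in> lcarrier n_alg"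
    "A $ 1 $ 2 = B $ 1 $ 2" "A $ 2 $ 1 = B $ 2 $ 1" "A $ 1 $ 1 = B $ 1 $ 1"
    "A $ 4 $ 5 = B $ 4 $ 5" "A $ 5 $ 4 = B $ 5 $ 4" "A $ 4 $ 4 = B $ 4 $ 4"
  shows "A = B"
  using assms(3-) n_algD[OF assms(1)] n_algD[OF assms(2)] by (simp add: vec_eq_iff forall_5)

lemma n_subspace: "mat.subspace (lcarrier n_alg)"
  by (auto simp: mat.subspace_def n_algD intro!: n_algI)

lemma n_commutator_closed:
  "A \<in> lcarrier n_alg \<Longrightarrow> B \<in> lcarrier n_alg \<Longrightarrow> commutator A B \<in> lcarrier n_alg"
  by (rule n_algI) (simp_all add: commutator_def matrix_matrix_mult_def sum_5 n_algD algebra_simps)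

lemma n_commutator_entries:
  assumes "A \<in> lcarrier n_alg" "B \<in> lcarrier n_alg"
  shows "commutator A B $ 1 $ 2 = 2 * (A $ 1 $ 1 * B $ 1 $ 2 - A $ 1 $ 2 * B $ 1 $ 1)"
    and "commutator A B $ 2 $ 1 = 2 * (A $ 2 $ 1 * B $ 1 $ 1 - A $ 1 $ 1 * B $ 2 $ 1)"
    and "commutator A B $ 1 $ 1 = A $ 1 $ 2 * B $ 2 $ 1 - A $ 2 $ 1 * B $ 1 $ 2"
    and "commutator A B $ 4 $ 5 = 2 * (A $ 4 $ 4 * B $ 4 $ 5 - A $ 4 $ 5 * B $ 4 $ 4)"
    and "commutator A B $ 5 $ 4 = 2 * (A $ 5 $ 4 * B $ 4 $ 4 - A $ 4 $ 4 * B $ 5 $ 4)"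
    and "commutator A B $ 4 $ 4 = A $ 4 $ 5 * B $ 5 $ 4 - A $ 5 $ 4 * B $ 4 $ 5"
  using assms
  by (simp_all add: commutator_def matrix_matrix_mult_def sum_5 n_algD algebra_simps)

lemma n_alg_lie_algebra: "lie_algebra n_alg"
  using commutator_lie_algebra[OF n_subspace n_commutator_closed] by (simp add: n_alg_def)

lemma e_nth:
  "e 1 $ i $ j = of_bool (i = 1 \<and> j = 2)" "e 2 $ i $ j = of_bool (i = 2 \<and> j = 1)"
  "e 3 $ i $ j = of_bool (i = 1 \<and> j = 1) - of_bool (i = 2 \<and> j = 2)"
  "e 4 $ i $ j = of_bool (i = 4 \<and> j = 5)" "e 5 $ i $ j = of_bool (i = 5 \<and> j = 4)"
  "e 6 $ i $ j = of_bool (i = 4 \<and> j = 4) - of_bool (i = 5 \<and> j = 5)"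
  by (simp_all add: e_def matrix_unit_def axis_def)

lemma e_in_n: "e i \<in> lcarrier n_alg"
  by (rule n_algI) (simp_all add: e_def matrix_unit_def axis_def)

(* The simplifier rewrites the natural number 1 to Suc 0. *)
lemmas e_entries = e_nth e_nth(1)[unfolded One_nat_def]

definition combination :: "complex \<Rightarrow> complex \<Rightarrow> complex \<Rightarrow> complex \<Rightarrow> complex \<Rightarrow> complex \<Rightarrow> complex^5^5" where
  "combination a b c d f g = matrix_scale a (e 1) + matrix_scale b (e 2) + matrix_scale c (e 3)
     + matrix_scale d (e 4) + matrix_scale f (e 5) + matrix_scale g (e 6)"

lemma combination_in_n: "combination a b c d f g \<in> lcarrier n_alg"
  unfolding combination_def by (intro mat.subspace_add mat.subspace_scale n_subspace e_in_n)

lemma combination_entries [simp]: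
  "combination a b c d f g $ 1 $ 2 = a" "combination a b c d f g $ 2 $ 1 = b"
  "combination a b c d f g $ 1 $ 1 = c" "combination a b c d f g $ 4 $ 5 = d"
  "combination a b c d f g $ 5 $ 4 = f" "combination a b c d f g $ 4 $ 4 = g"
  by (simp_all add: combination_def e_entries)

lemma n_alg_combination:
  assumes "A \<in> lcarrier n_alg"
  shows "A = combination (A $ 1 $ 2) (A $ 2 $ 1) (A $ 1 $ 1) (A $ 4 $ 5) (A $ 5 $ 4) (A $ 4 $ 4)"
  using assms combination_in_n by (rule n_alg_eqI) simp_all

lemma indices: "{1..6} = {1, 2, 3, 4, 5, 6 :: nat}"
  by auto

lemma inj_on_e: "inj_on e {1..6}"
  unfolding inj_on_def indices by (simp add: vec_eq_iff forall_5 e_entries)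

lemma span_e: "mat.span (e ` {1..6}) = lcarrier n_alg"
proof
  show "mat.span (e ` {1..6}) \<subseteq> lcarrier n_alg"
    using e_in_n n_subspace by (intro mat.span_minimal) auto
  show "lcarrier n_alg \<subseteq> mat.span (e ` {1..6})"
  proof
    fix A assume "A \<in> lcarrier n_alg"
    then have "A = combination (A $ 1 $ 2) (A $ 2 $ 1) (A $ 1 $ 1) (A $ 4 $ 5) (A $ 5 $ 4) (A $ 4 $ 4)"
      by (rule n_alg_combination)
    also have "\<dots> \<in> mat.span (e ` {1..6})"
      unfolding combination_def by (intro mat.span_add mat.span_scale mat.span_base imageI) auto
    finally show "A \<in> mat.span (e ` {1..6})" .
  qed
qed

lemma independent_e: "\<not> mat.dependent (e ` {1..6})"
proof
  assume "mat.dependent (e ` {1..6})"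
  then obtain u where u: "\<exists>i\<in>{1..6}. u (e i) \<noteq> 0"
      and "(\<Sum>v\<in>e ` {1..6}. matrix_scale (u v) v) = 0"
    by (auto simp: mat.dependent_finite)
  then have "(\<Sum>i\<in>{1..6}. matrix_scale (u (e i)) (e i)) = 0"
    by (simp only: sum.reindex[OF inj_on_e] o_def)
  then have "combination (u (e 1)) (u (e 2)) (u (e 3)) (u (e 4)) (u (e 5)) (u (e 6)) = 0" (is "?C = 0")
    unfolding indices combination_def by (simp add: add.assoc)
  then have "?C $ i $ j = 0" for i j by simp
  from this[of 1 2] this[of 2 1] this[of 1 1] this[of 4 5] this[of 5 4] this[of 4 4] u
  show False unfolding indices by simp
qed

definition blocks :: "complex^5^5 \<Rightarrow> (complex^2^2) \<times> (complex^2^2)" where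
  "blocks A = ((\<chi> i j. A $ (if i = 1 then 1 else 2) $ (if j = 1 then 1 else 2)),
               (\<chi> i j. A $ (if i = 1 then 4 else 5) $ (if j = 1 then 4 else 5)))"

lemma n_alg_iso_sl2_sum: "n_alg \<cong>\<^sub>L sl2 \<oplus>\<^sub>L sl2"
proof -
  define assemble where "assemble = (\<lambda>(B :: complex^2^2, C :: complex^2^2).
      combination (B $ 1 $ 2) (B $ 2 $ 1) (B $ 1 $ 1) (C $ 1 $ 2) (C $ 2 $ 1) (C $ 1 $ 1))"
  have carrier: "lcarrier (sl2 \<oplus>\<^sub>L sl2) = {(B, C). trace B = 0 \<and> trace C = 0}"
    by (auto simp: lie_direct_sum_def sl2_def)
  have "carrier_linear n_alg (sl2 \<oplus>\<^sub>L sl2) blocks"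
    unfolding carrier_linear_def carrier
    by (auto simp: blocks_def trace_def sum_2 n_algD lie_direct_sum_def sl2_def vec_eq_iff)
  moreover have "blocks (commutator A B) = lbracket (sl2 \<oplus>\<^sub>L sl2) (blocks A) (blocks B)"
    if "A \<in> lcarrier n_alg" "B \<in> lcarrier n_alg" for A B
    using that by (simp add: blocks_def lie_direct_sum_def sl2_def vec_eq_iff commutator_def
        matrix_matrix_mult_def sum_5 sum_2 n_algD)
  moreover have "bij_betw blocks (lcarrier n_alg) (lcarrier (sl2 \<oplus>\<^sub>L sl2))"
  proof (rule bij_betw_byWitness[where f' = assemble])
    show "\<forall>A\<in>lcarrier n_alg. assemble (blocks A) = A"
      using n_alg_combination by (auto simp: assemble_def blocks_def)
    show "\<forall>X\<in>lcarrier (sl2 \<oplus>\<^sub>L sl2). blocks (assemble X) = X"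
      unfolding carrier
      by (auto simp: assemble_def blocks_def trace_def sum_2 vec_eq_iff forall_2
          n_algD[OF combination_in_n] add_eq_0_iff2)
    show "blocks ` lcarrier n_alg \<subseteq> lcarrier (sl2 \<oplus>\<^sub>L sl2)"
      unfolding carrier by (auto simp: blocks_def trace_def sum_2 n_algD)
    show "assemble ` lcarrier (sl2 \<oplus>\<^sub>L sl2) \<subseteq> lcarrier n_alg"
      by (auto simp: assemble_def combination_in_n)
  qed
  ultimately show ?thesis
    unfolding lie_isomorphic_def by auto
qed

section \<open>The Rota-Baxter operator and its descendent algebra\<close>

text \<open>The map \<open>\<phi>\<close>: the entries \<open>A $ 2 $ 1\<close> and \<open>A $ 5 $ 4\<close> are the coordinates of \<open>A\<close> at \<open>e 2\<close>
  and \<open>e 5\<close>.\<close>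

definition rb_operator :: "complex^5^5 \<Rightarrow> complex^5^5" where
  "rb_operator A = - matrix_scale (A $ 2 $ 1) (e 2) - matrix_scale (A $ 5 $ 4) (e 3 + e 5)"

lemma rb_operator_in_n: "rb_operator A \<in> lcarrier n_alg"
  unfolding rb_operator_def
  by (intro mat.subspace_diff mat.subspace_neg mat.subspace_add mat.subspace_scale n_subspace e_in_n)

lemma rb_operator_entries [simp]:
  "rb_operator A $ 1 $ 2 = 0" "rb_operator A $ 2 $ 1 = - A $ 2 $ 1"
  "rb_operator A $ 1 $ 1 = - A $ 5 $ 4" "rb_operator A $ 4 $ 5 = 0"
  "rb_operator A $ 5 $ 4 = - A $ 5 $ 4" "rb_operator A $ 4 $ 4 = 0"
  by (simp_all add: rb_operator_def e_entries)

lemma rb_operator_linear: "carrier_linear n_alg n_alg rb_operator"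
  by (auto simp: carrier_linear_def rb_operator_in_n)
     (simp_all add: rb_operator_def vec_eq_iff algebra_simps)

abbreviation g_bracket where "g_bracket \<equiv> descendent_bracket n_alg rb_operator"

lemma g_bracket_in_n:
  "A \<in> lcarrier n_alg \<Longrightarrow> B \<in> lcarrier n_alg \<Longrightarrow> g_bracket A B \<in> lcarrier n_alg"
  by (simp add: descendent_bracket_def mat.subspace_add n_subspace n_commutator_closed rb_operator_in_n)

text \<open>The brackets lie in \<open>\<langle>e 1, e 2, e 4\<rangle>\<close>. Each of the three coordinates has the form
  \<open>a b' - b a'\<close> of the bracket of \<open>r2\<close>, for linear forms \<open>a\<close> and \<open>b\<close>. These six forms give
  the isomorphism with \<open>r2 \<oplus>\<^sub>L r2 \<oplus>\<^sub>L r2\<close>.\<close>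

lemma g_bracket_entries:
  assumes "A \<in> lcarrier n_alg" "B \<in> lcarrier n_alg"
  shows "g_bracket A B $ 1 $ 2 =
      2 * (A $ 1 $ 2 * (B $ 5 $ 4 - B $ 1 $ 1) - (A $ 5 $ 4 - A $ 1 $ 1) * B $ 1 $ 2)"
    and "g_bracket A B $ 2 $ 1 = 2 * (A $ 5 $ 4 * B $ 2 $ 1 - A $ 2 $ 1 * B $ 5 $ 4)"
    and "g_bracket A B $ 1 $ 1 = 0"
    and "g_bracket A B $ 4 $ 5 = 2 * (A $ 4 $ 4 * B $ 4 $ 5 - A $ 4 $ 5 * B $ 4 $ 4)"
    and "g_bracket A B $ 5 $ 4 = 0"
    and "g_bracket A B $ 4 $ 4 = 0"
  using assms
  by (simp_all add: descendent_bracket_def n_commutator_entries rb_operator_in_n algebra_simps)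

text \<open>On elements of the same summand of \<open>\<aa> \<oplus> \<bb>\<close> the identity says that the summand is a subalgebra; on
  mixed elements both sides vanish. In coordinates only the entry at \<open>e 2\<close> is nonzero on either
  side, since \<open>{\<bb>, \<bb>}\<close> is spanned by \<open>e 2\<close>.\<close>

lemma rb_operator_rota_baxter: "rota_baxter n_alg rb_operator"
proof -
  have "rb_operator (g_bracket A B) = commutator (rb_operator A) (rb_operator B)"
    if "A \<in> lcarrier n_alg" "B \<in> lcarrier n_alg" for A B
    using that by (intro n_alg_eqI rb_operator_in_n n_commutator_closed)
      (simp_all add: g_bracket_entries n_commutator_entries rb_operator_in_n algebra_simps)
  then show ?thesis
    by (simp add: rota_baxter_def rb_operator_linear)
qed

abbreviation g_alg where "g_alg \<equiv> n_alg\<lparr>lbracket := g_bracket\<rparr>"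

lemma g_alg_iso_r2_sum: "g_alg \<cong>\<^sub>L r2 \<oplus>\<^sub>L r2 \<oplus>\<^sub>L r2"
proof -
  \<comment> \<open>Each pair lists the coordinates of \<open>f\<^sub>1\<close> and \<open>f\<^sub>2\<close>. The first is the coordinate at \<open>e 1\<close>,
    \<open>e 2\<close> or \<open>e 4\<close>, and the second is the linear form by which the bracket acts on it.\<close>
  define f where "f A = ((A $ 1 $ 2, 2 * (A $ 5 $ 4 - A $ 1 $ 1)), (A $ 2 $ 1, - 2 * A $ 5 $ 4),
      (A $ 4 $ 5, - 2 * A $ 4 $ 4))" for A :: "complex^5^5"
  \<comment> \<open>The inverse of \<open>f\<close>: solve \<open>u = 2 (x\<^sub>5 - x\<^sub>3)\<close>, \<open>v = -2 x\<^sub>5\<close>, \<open>w = -2 x\<^sub>6\<close> for the coordinates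
    \<open>x\<^sub>3\<close>, \<open>x\<^sub>5\<close>, \<open>x\<^sub>6\<close>.\<close>
  define h where "h = (\<lambda>((a, u), (b, v), (d, w)).
      combination a b (- (u + v) / 2) d (- v / 2) (- w / 2))"
  have carrier: "lcarrier (r2 \<oplus>\<^sub>L r2 \<oplus>\<^sub>L r2) = UNIV"
    by (simp add: lie_direct_sum_def r2_def)
  have "carrier_linear g_alg (r2 \<oplus>\<^sub>L r2 \<oplus>\<^sub>L r2) f"
    unfolding carrier_linear_def carrier
    by (simp add: f_def lie_direct_sum_def r2_def algebra_simps)
  moreover have "f (g_bracket A B) = lbracket (r2 \<oplus>\<^sub>L r2 \<oplus>\<^sub>L r2) (f A) (f B)"
    if "A \<in> lcarrier n_alg" "B \<in> lcarrier n_alg" for A B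
    using that by (simp add: f_def lie_direct_sum_def r2_def g_bracket_entries algebra_simps)
  moreover have "bij_betw f (lcarrier n_alg) UNIV"
  proof (rule bij_betw_byWitness[where f' = h])
    show "\<forall>A\<in>lcarrier n_alg. h (f A) = A"
      by (auto simp: f_def h_def intro!: n_alg_combination[symmetric])
    show "\<forall>X\<in>UNIV. f (h X) = X"
      by (auto simp: f_def h_def field_simps)
  qed (auto simp: h_def combination_in_n)
  ultimately show ?thesis
    unfolding lie_isomorphic_def carrier by auto
qed

lemma n_alg_eq_iff:
  assumes "A \<in> lcarrier n_alg" "B \<in> lcarrier n_alg"
  shows "A = B \<longleftrightarrow> A $ 1 $ 2 = B $ 1 $ 2 \<and> A $ 2 $ 1 = B $ 2 $ 1 \<and> A $ 1 $ 1 = B $ 1 $ 1 \<and>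
    A $ 4 $ 5 = B $ 4 $ 5 \<and> A $ 5 $ 4 = B $ 5 $ 4 \<and> A $ 4 $ 4 = B $ 4 $ 4"
  using n_alg_eqI[OF assms] by auto

lemmas n_closed = e_in_n rb_operator_in_n n_commutator_closed g_bracket_in_n
  mat.subspace_scale[OF n_subspace] mat.subspace_0[OF n_subspace]
  mat.subspace_neg[OF n_subspace] mat.subspace_diff[OF n_subspace]

lemma rb_operator_e:
  "rb_operator (e 2) = - e 2" "rb_operator (e 5) = - e 3 - e 5"
  "rb_operator (e 1) = 0" "rb_operator (e 3) = 0" "rb_operator (e 4) = 0" "rb_operator (e 6) = 0"
  by (simp_all add: rb_operator_def e_entries mat.scale_right_distrib)

lemma g_bracket_e:
  "g_bracket (e 1) (e 3) = matrix_scale (-2) (e 1)"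
  "g_bracket (e 1) (e 5) = matrix_scale 2 (e 1)"
  "g_bracket (e 2) (e 5) = matrix_scale (-2) (e 2)"
  "g_bracket (e 4) (e 6) = matrix_scale (-2) (e 4)"
  "\<forall>i\<in>{1..6}. \<forall>j\<in>{1..6}. i < j \<and> (i, j) \<notin> {(1,3), (1,5), (2,5), (4,6)} \<longrightarrow>
     g_bracket (e i) (e j) = 0"
  unfolding indices by (simp_all add: n_alg_eq_iff n_closed g_bracket_entries e_entries)

lemma product_e:
  "commutator (rb_operator (e 2)) (e 1) = e 3"
  "commutator (rb_operator (e 2)) (e 3) = matrix_scale (-2) (e 2)"
  "commutator (rb_operator (e 5)) (e 1) = matrix_scale (-2) (e 1)"
  "commutator (rb_operator (e 5)) (e 2) = matrix_scale 2 (e 2)"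
  "commutator (rb_operator (e 5)) (e 4) = e 6"
  "commutator (rb_operator (e 5)) (e 6) = matrix_scale (-2) (e 5)"
  "\<forall>i\<in>{1..6}. \<forall>j\<in>{1..6}. (i, j) \<notin> {(2,1), (2,3), (5,1), (5,2), (5,4), (5,6)} \<longrightarrow>
     commutator (rb_operator (e i)) (e j) = 0"
  unfolding indices by (simp_all add: n_alg_eq_iff n_closed n_commutator_entries e_entries)

theorem proposition4p4:
  shows "lie_algebra n_alg \<and> n_alg \<cong>\<^sub>L sl2 \<oplus>\<^sub>L sl2 \<and>
    inj_on e {1..6} \<and> \<not> module.dependent matrix_scale (e ` {1..6}) \<and>
    module.span matrix_scale (e ` {1..6}) = lcarrier n_alg \<and>
    (\<exists>\<gg> \<phi> p.
       post_lie_structure \<gg> n_alg p \<and>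
       \<gg> \<cong>\<^sub>L r2 \<oplus>\<^sub>L r2 \<oplus>\<^sub>L r2 \<and>
       carrier_linear n_alg n_alg \<phi> \<and>
       \<phi> (e 2) = - e 2 \<and> \<phi> (e 5) = - e 3 - e 5 \<and>
       \<phi> (e 1) = 0 \<and> \<phi> (e 3) = 0 \<and> \<phi> (e 4) = 0 \<and> \<phi> (e 6) = 0 \<and>
       (\<forall>x\<in>lcarrier n_alg. \<forall>y\<in>lcarrier n_alg. p x y = lbracket n_alg (\<phi> x) y) \<and>
       lbracket \<gg> (e 1) (e 3) = matrix_scale (-2) (e 1) \<and>
       lbracket \<gg> (e 1) (e 5) = matrix_scale 2 (e 1) \<and>
       lbracket \<gg> (e 2) (e 5) = matrix_scale (-2) (e 2) \<and>
       lbracket \<gg> (e 4) (e 6) = matrix_scale (-2) (e 4) \<and>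
       (\<forall>i\<in>{1..6}. \<forall>j\<in>{1..6}. i < j \<and> (i, j) \<notin> {(1,3), (1,5), (2,5), (4,6)} \<longrightarrow>
          lbracket \<gg> (e i) (e j) = 0) \<and>
       p (e 2) (e 1) = e 3 \<and>
       p (e 2) (e 3) = matrix_scale (-2) (e 2) \<and>
       p (e 5) (e 1) = matrix_scale (-2) (e 1) \<and>
       p (e 5) (e 2) = matrix_scale 2 (e 2) \<and>
       p (e 5) (e 4) = e 6 \<and>
       p (e 5) (e 6) = matrix_scale (-2) (e 5) \<and>
       (\<forall>i\<in>{1..6}. \<forall>j\<in>{1..6}.
          (i, j) \<notin> {(2,1), (2,3), (5,1), (5,2), (5,4), (5,6)} \<longrightarrow> p (e i) (e j) = 0))"
proof -
  have post_lie: "post_lie_structure g_alg n_alg (\<lambda>x y. commutator (rb_operator x) y)"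
    using rota_baxter_post_lie[OF n_alg_lie_algebra rb_operator_rota_baxter] by simp
  have g_sel: "lbracket g_alg = g_bracket"
    by simp
  show ?thesis
    by (intro conjI exI[of _ g_alg] exI[of _ rb_operator]
          exI[of _ "\<lambda>x y. commutator (rb_operator x) y"])
       (unfold n_alg_sel g_sel,
         (rule post_lie n_alg_lie_algebra n_alg_iso_sl2_sum inj_on_e independent_e span_e
           g_alg_iso_r2_sum rb_operator_linear rb_operator_e g_bracket_e product_e ballI refl)+)
qed

end
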